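(* Let $1<q<p$, $q<N$, $s\ge 0$, $0\le m\le q-1$ and $$s(N-q)+m(N-1)<N(q-1).$$ Let $\Omega\subset\mathbb R^N$ be an exterior domain and let $u\in C(\overline\Omega)\cap C^1(\Omega)$ be a positive solution of $$-\Delta_p u-\Delta_q u\ge u^s|\nabla u|^m\quad\text{in }\Omega .$$ Then, for any $\theta>0$, there exists a constant $C>0$, depending on $\theta$, $\Omega$ and $u$, such that $$u(x)\ge C|x|^{-\theta}\quad\text{in }\overline\Omega\cap\{|x|\ge 1\}.$$
   Context: For $r>1$, $\Delta_r u=\operatorname{div}(|\nabla u|^{r-2}\nabla u)$. An exterior domain is a domain $\Omega\subset\mathbb R^N$ with $\Omega\supset\{x:|x|>R\}$ for some $R>0$. A non-negative function $u\in C^1(\Omega)$ is a solution of $-\Delta_p u-\Delta_q u\ge u^s|\nabla u|^m$ in $\Omega$ if $$\int_\Omega |\nabla u|^{p-2}\nabla u\cdot\nabla\varphi\,dx+\int_\Omega |\nabla u|^{q-2}\nabla u\cdot\nabla\varphi\,dx\ge \int_\Omega u^s|\nabla u|^m\varphi\,dx\quad\text{for all }\varphi\in C^1_c(\Omega),\ \varphi\ge 0.$$ When $m=0$ the factor $|\nabla u|^m$ is identically $1$.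
   Formalization: "Positive" is taken to mean u > 0 on the closure of Ω; if u is positive only in Ω it may vanish on the boundary at points with |x| ≥ 1, and the claimed lower bound then fails there. *)

theory Defs
  imports "HOL-Analysis.Analysis"
begin

definition exterior_domain :: "(real ^ 'n) set \<Rightarrow> bool" where
  "exterior_domain \<Omega> \<longleftrightarrow> open \<Omega> \<and> connected \<Omega> \<and> (\<exists>R>0. {x. norm x > R} \<subseteq> \<Omega>)"

definition grad :: "(real ^ 'n \<Rightarrow> real) \<Rightarrow> real ^ 'n \<Rightarrow> real ^ 'n" where
  "grad f x = (THE D. GDERIV f x :> D)"

lemma grad_eq:
  assumes "GDERIV f x :> D"
  shows "grad f x = D"
proof -
  have "E = D" if "GDERIV f x :> E" for E
    using has_derivative_unique[OF that[unfolded gderiv_def] assms[unfolded gderiv_def]]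
    by (metis inner_commute vector_eq_rdot)
  then show ?thesis
    unfolding grad_def using assms by blast
qed

definition C1_on :: "(real ^ 'n) set \<Rightarrow> (real ^ 'n \<Rightarrow> real) \<Rightarrow> bool" where
  "C1_on S f \<longleftrightarrow> (\<forall>x\<in>S. \<exists>D. GDERIV f x :> D) \<and> continuous_on S (grad f)"

text \<open>Test functions are represented by their extensions by zero to the whole space.\<close>

definition C1_compact_support :: "(real ^ 'n) set \<Rightarrow> (real ^ 'n \<Rightarrow> real) \<Rightarrow> bool" where
  "C1_compact_support \<Omega> \<phi> \<longleftrightarrow>
     C1_on UNIV \<phi> \<and> compact (closure {x. \<phi> x \<noteq> 0}) \<and> closure {x. \<phi> x \<noteq> 0} \<subseteq> \<Omega>"

text \<open>Powers with real exponent of non-negative reals, with the convention that the zeroth power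
  is identically \<open>1\<close>; for the library function, \<open>0 powr 0 = 0\<close>.\<close>

definition npow :: "real \<Rightarrow> real \<Rightarrow> real" where
  "npow t a = (if a = 0 then 1 else t powr a)"

text \<open>The vector field \<open>|\<xi>|\<^sup>r\<^sup>-\<^sup>2 \<xi>\<close>, with value \<open>0\<close> at \<open>\<xi> = 0\<close>; it is continuous for \<open>r > 1\<close>.\<close>

definition flux :: "real \<Rightarrow> real ^ 'n \<Rightarrow> real ^ 'n" where
  "flux r \<xi> = (norm \<xi> powr (r - 2)) *\<^sub>R \<xi>"

text \<open>Non-negative weak solutions of \<open>-\<Delta>\<^sub>p u - \<Delta>\<^sub>q u \<ge> u\<^sup>s |\<nabla>u|\<^sup>m\<close> in \<open>\<Omega>\<close>.
  For \<open>p, q > 1\<close>, \<open>s, m \<ge> 0\<close> and open \<open>\<Omega>\<close> the three integrands are continuous with compact support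
  in \<open>\<Omega>\<close>, so the integrals exist.\<close>

definition pq_solution ::
  "real \<Rightarrow> real \<Rightarrow> real \<Rightarrow> real \<Rightarrow> (real ^ 'n) set \<Rightarrow> (real ^ 'n \<Rightarrow> real) \<Rightarrow> bool" where
  "pq_solution p q s m \<Omega> u \<longleftrightarrow>
     C1_on \<Omega> u \<and> (\<forall>x\<in>\<Omega>. 0 \<le> u x) \<and>
     (\<forall>\<phi>. C1_compact_support \<Omega> \<phi> \<and> (\<forall>x. 0 \<le> \<phi> x) \<longrightarrow>
        (LINT x:\<Omega>|lborel. flux p (grad u x) \<bullet> grad \<phi> x)
          + (LINT x:\<Omega>|lborel. flux q (grad u x) \<bullet> grad \<phi> x)
        \<ge> (LINT x:\<Omega>|lborel. npow (u x) s * npow (norm (grad u x)) m * \<phi> x))"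

end

theory Submission
  imports Defs
begin

text \<open>
  The function \<open>u\<close> is compared with radial powers \<open>k |x|\<^sup>-\<^sup>\<gamma>\<close> near infinity. For such a power,
  \<open>-\<Delta>\<^sub>q\<close> is a multiple of \<open>|x| powr (-((\<gamma> + 1) (q - 1) + 1))\<close>, and \<open>-\<Delta>\<^sub>p\<close> decays faster.

  A first bound uses only that the right-hand side of the inequality is non-negative. If
  \<open>\<gamma> > \<gamma>0 = (N - q)/(q - 1)\<close>, the exponent of the fundamental solution of \<open>\<Delta>\<^sub>q\<close>, then
  \<open>-\<Delta>\<^sub>p - \<Delta>\<^sub>q\<close> is negative on \<open>k |x|\<^sup>-\<^sup>\<gamma>\<close>, so \<open>u\<close> is bounded below by some multiple of \<open>|x|\<^sup>-\<^sup>\<gamma>\<close>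
  (\<open>decays_at_most_above_fundamental\<close>).

  A bound of order \<open>|x|\<^sup>-\<^sup>\<gamma>\<close> makes the factor \<open>u\<^sup>s\<close> at least a multiple of \<open>|x| powr (-\<gamma> s)\<close>. The
  right-hand side then dominates, near infinity, both operators on a power with a smaller exponent \<open>\<gamma>'\<close>, provided
  that \<open>(\<gamma>' + 1) (q - 1 - m) + 1 > \<gamma> s\<close>, and \<open>u\<close> is bounded below by a multiple of that power
  (\<open>decays_at_most_improve\<close>). For \<open>\<gamma>' = \<gamma>\<close> this condition is affine in \<open>\<gamma>\<close>; it holds at \<open>0\<close>, and at
  \<open>\<gamma>0\<close> it is the hypothesis \<open>s (N - q) + m (N - 1) < N (q - 1)\<close>. So it holds with a uniform
  margin on an interval reaching beyond \<open>\<gamma>0\<close>, and finitely many steps reach any \<open>\<theta> > 0\<close>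
  (\<open>decays_at_most_every_power\<close>).

  Both bounds rest on one comparison argument (\<open>weak_comparison\<close>): at a positive interior maximum of
  \<open>v - u\<close> the gradients agree, so the gradient term can be computed from \<open>v\<close>. Since \<open>u\<close> is of class
  \<open>C\<^sup>1\<close>, the inequality survives near the maximum, and the squared positive part of \<open>v - u - c\<close>
  is an admissible test function that produces a contradiction. The weak form of the equation for the
  barrier follows from the behaviour of integrals under dilations (\<open>integral_euler_field\<close>).
\<close>

section \<open>Gradients and test functions\<close>

lemma integrable_continuous_compact_support:
  fixes f :: "'a::euclidean_space \<Rightarrow> real"
  assumes "compact K" "continuous_on K f" "\<And>x. x \<notin> K \<Longrightarrow> f x = 0"
  shows "integrable lborel f"
proof -
  have "(\<lambda>x. indicator K x *\<^sub>R f x) = f"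
    using assms(3) by (auto simp: indicator_def fun_eq_iff)
  then show ?thesis
    using borel_integrable_compact[OF assms(1,2)] by simp
qed

lemma GDERIV_imp_isCont: "GDERIV f x :> D \<Longrightarrow> isCont f x"
  unfolding gderiv_def by (rule has_derivative_continuous)

lemma C1_on_GDERIV: "C1_on S f \<Longrightarrow> x \<in> S \<Longrightarrow> GDERIV f x :> grad f x"
  unfolding C1_on_def using grad_eq by metis

lemma C1_on_continuous: "C1_on S f \<Longrightarrow> continuous_on S f"
  by (meson C1_on_GDERIV GDERIV_imp_isCont continuous_at_imp_continuous_on)

lemma C1_onI:
  assumes "\<And>x. x \<in> S \<Longrightarrow> GDERIV f x :> G x" "continuous_on S G"
  shows "C1_on S f"
proof -
  have "grad f x = G x" if "x \<in> S" for x
    using assms(1) grad_eq that by blast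
  then show ?thesis
    unfolding C1_on_def using assms by (metis continuous_on_cong)
qed

lemma GDERIV_cong_open:
  assumes "GDERIV f x :> D" "open S" "x \<in> S" "\<And>y. y \<in> S \<Longrightarrow> g y = f y"
  shows "GDERIV g x :> D"
  unfolding gderiv_def
  by (rule has_derivative_transform_within_open[OF assms(1)[unfolded gderiv_def] assms(2,3)])
     (use assms(4) in simp)

text \<open>The complement of the closed support is open, and the function is zero there, so the gradient
  vanishes as well.\<close>

lemma
  assumes "C1_compact_support S \<phi>" "x \<notin> closure {x. \<phi> x \<noteq> 0}"
  shows C1_compact_support_eq_0: "\<phi> x = 0"
    and C1_compact_support_grad_eq_0: "grad \<phi> x = 0"
proof -
  have out: "\<phi> y = 0" if "y \<in> - closure {x. \<phi> x \<noteq> 0}" for y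
    using that closure_subset[of "{x. \<phi> x \<noteq> 0}"] by auto
  show "\<phi> x = 0" using assms(2) by (intro out) simp
  have "GDERIV \<phi> x :> 0"
  proof (rule GDERIV_cong_open[OF GDERIV_const[of 0]])
    show "x \<in> - closure {x. \<phi> x \<noteq> 0}" using assms(2) by simp
  qed (use out in blast)+
  then show "grad \<phi> x = 0" by (rule grad_eq)
qed

lemma C1_compact_supportI:
  assumes "\<And>x. GDERIV \<phi> x :> G x" "continuous_on UNIV G"
    and "compact K" "K \<subseteq> S" "\<And>x. x \<notin> K \<Longrightarrow> \<phi> x = 0"
  shows "C1_compact_support S \<phi>"
proof -
  have "closure {x. \<phi> x \<noteq> 0} \<subseteq> K"
    using assms(3,5) by (intro closure_minimal) (auto intro: compact_imp_closed)
  then show ?thesis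
    unfolding C1_compact_support_def
    using C1_onI[OF assms(1,2)] assms(3,4) 
    by (metis (no_types, lifting) closed_Int_compact closed_closure compact_imp_closed inf.absorb1
        order.trans)
qed

section \<open>Radial integration by parts\<close>

lemma integral_scaleR_arg:
  fixes f :: "'a::euclidean_space \<Rightarrow> real"
  assumes "f \<in> borel_measurable borel" "0 < t"
  shows "(LINT x|lborel. f (t *\<^sub>R x)) = (LINT x|lborel. f x) / t ^ DIM('a)"
proof -
  have "(LINT x|lborel. f x) = (LINT x|density (distr lborel borel (\<lambda>x. 0 + t *\<^sub>R x)) (\<lambda>_. \<bar>t\<bar>^DIM('a)). f x)"
    using lborel_affine[of t "0::'a"] assms(2) by simp
  also have "\<dots> = t ^ DIM('a) * (LINT x|lborel. f (t *\<^sub>R x))"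
    using assms by (subst integral_density) (auto simp: integral_distr)
  finally show ?thesis using assms(2) by simp
qed

text \<open>The dilated integral \<open>\<integral> \<psi>(t x) dx\<close> equals \<open>t\<^sup>-\<^sup>N \<integral> \<psi>\<close>. Differentiating both sides at
  \<open>t = 1\<close> gives the identity; this is the divergence theorem for the field \<open>x\<close>, which has constant
  divergence \<open>N\<close>. The derivative is taken along the sequence \<open>t\<^sub>n = 1 + 1/(n+1)\<close>, and the mean value
  theorem bounds the difference quotients by a multiple of the indicator of one fixed ball.\<close>

lemma integral_euler_field:
  fixes \<psi> :: "real ^ 'n \<Rightarrow> real"
  assumes "C1_compact_support S \<psi>"
  shows "(LINT x|lborel. x \<bullet> grad \<psi> x) = - real CARD('n) * (LINT x|lborel. \<psi> x)"
proof -
  let ?K = "closure {x. \<psi> x \<noteq> 0}"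
  have C1: "C1_on UNIV \<psi>" and K: "compact ?K"
    using assms by (auto simp: C1_compact_support_def)
  note G = C1_on_GDERIV[OF C1 UNIV_I]
  have cont: "continuous_on UNIV \<psi>" using C1 by (rule C1_on_continuous)
  have cg: "continuous_on UNIV (grad \<psi>)" using C1 by (auto simp: C1_on_def)
  obtain B where B: "B > 0" "\<And>x. x \<in> ?K \<Longrightarrow> norm x \<le> B"
    using compact_imp_bounded[OF K] by (auto simp: bounded_pos)
  have zero: "\<psi> x = 0" if "norm x > B" for x
    using C1_compact_support_eq_0[OF assms, of x] B(2)[of x] that by linarith
  have "bounded (grad \<psi> ` cball 0 (2*B))"
    by (intro compact_imp_bounded compact_continuous_image continuous_on_subset[OF cg]) auto
  then obtain L where L: "L > 0" "\<And>x. norm x \<le> 2*B \<Longrightarrow> norm (grad \<psi> x) \<le> L"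
    by (auto simp: bounded_pos)
  define t where "t n = 1 + 1 / real (n + 1)" for n
  have t: "t n > 1" "t n \<le> 2" for n by (auto simp: t_def field_simps)
  have t_lim: "t \<longlonglongrightarrow> 1"
  proof -
    have "(\<lambda>n. 1 + inverse (real (Suc n))) = t"
      by (simp add: t_def fun_eq_iff inverse_eq_divide)
    then show ?thesis
      using tendsto_add[OF tendsto_const[of "1::real"] LIMSEQ_inverse_real_of_nat] by simp
  qed
  moreover have "t n \<noteq> 1" for n using t(1)[of n] by simp
  ultimately have t_at: "filterlim t (at 1) sequentially"
    by (simp add: filterlim_at)
  define Q where "Q n x = (\<psi> (t n *\<^sub>R x) - \<psi> x) / (t n - 1)" for n x
  have deriv: "((\<lambda>s. \<psi> (s *\<^sub>R x)) has_real_derivative (x \<bullet> grad \<psi> (s *\<^sub>R x))) (at s)" for x s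
  proof -
    have "((\<lambda>s. \<psi> (s *\<^sub>R x)) has_derivative (\<lambda>h. (h *\<^sub>R x) \<bullet> grad \<psi> (s *\<^sub>R x))) (at s)"
      by (rule has_derivative_compose[where g=\<psi>, OF _ G[unfolded gderiv_def]])
         (auto intro!: derivative_eq_intros)
    moreover have "(\<lambda>h. (h *\<^sub>R x) \<bullet> grad \<psi> (s *\<^sub>R x)) = (*) (x \<bullet> grad \<psi> (s *\<^sub>R x))"
      by (auto simp: fun_eq_iff)
    ultimately show ?thesis
      by (simp add: has_field_derivative_def)
  qed
  have lim: "(\<lambda>n. Q n x) \<longlonglongrightarrow> x \<bullet> grad \<psi> x" for x
  proof -
    have "((\<lambda>s. (\<psi> (s *\<^sub>R x) - \<psi> x) / (s - 1)) \<longlongrightarrow> x \<bullet> grad \<psi> x) (at 1)"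
      using deriv[of x 1] by (simp add: has_field_derivative_iff)
    then show ?thesis unfolding Q_def by (rule filterlim_compose[OF _ t_at])
  qed
  have big: "norm (t n *\<^sub>R x) > B" if "norm x > B" for n and x :: "real^'n"
  proof -
    have "1 * norm x \<le> t n * norm x"
      using t(1)[of n] by (intro mult_right_mono) auto
    then show ?thesis using that t(1)[of n] by simp
  qed
  have bound: "norm (Q n x) \<le> indicator (cball 0 B) x *\<^sub>R (B * L)" for n x
  proof (cases "norm x \<le> B")
    case True
    obtain z where z: "1 < z" "z < t n"
      "\<psi> (t n *\<^sub>R x) - \<psi> (1 *\<^sub>R x) = (t n - 1) * (x \<bullet> grad \<psi> (z *\<^sub>R x))"
      using MVT2[OF t(1) deriv] by metis
    have "norm (z *\<^sub>R x) \<le> 2 * B"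
      using True z t(2)[of n] by (auto intro!: mult_mono)
    then have "\<bar>x \<bullet> grad \<psi> (z *\<^sub>R x)\<bar> \<le> B * L"
      using True B(1) L by (intro order.trans[OF Cauchy_Schwarz_ineq2] mult_mono) auto
    moreover have "Q n x = x \<bullet> grad \<psi> (z *\<^sub>R x)"
      using z t(1)[of n] by (simp add: Q_def)
    ultimately show ?thesis using True by simp
  next
    case False
    moreover have "norm (t n *\<^sub>R x) > B"
      using False by (intro big) simp
    ultimately show ?thesis using zero by (simp add: Q_def)
  qed
  have m: "\<psi> \<in> borel_measurable borel" using cont by (rule borel_measurable_continuous_onI)
  have mg: "(\<lambda>x. x \<bullet> grad \<psi> x) \<in> borel_measurable borel"
    by (intro borel_measurable_continuous_onI continuous_intros cg)
  have lim_int: "(\<lambda>n. LINT x|lborel. Q n x) \<longlonglongrightarrow> (LINT x|lborel. x \<bullet> grad \<psi> x)"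
  proof (rule integral_dominated_convergence)
    show "(\<lambda>x. x \<bullet> grad \<psi> x) \<in> borel_measurable lborel" using mg by simp
    show "Q n \<in> borel_measurable lborel" for n
    proof -
      have "continuous_on UNIV (\<lambda>x. \<psi> (t n *\<^sub>R x))"
        by (intro continuous_on_compose2[OF cont] continuous_intros) auto
      then have "(\<lambda>x. \<psi> (t n *\<^sub>R x)) \<in> borel_measurable borel"
        by (rule borel_measurable_continuous_onI)
      then show ?thesis unfolding Q_def using m by simp
    qed
    show "integrable lborel (\<lambda>x::real^'n. indicator (cball 0 B) x *\<^sub>R (B * L))"
      by (intro borel_integrable_compact) auto
  qed (use lim bound in auto)
  have Q_eq: "(LINT x|lborel. Q n x) = (inverse (t n ^ CARD('n)) - 1) / (t n - 1) * (LINT x|lborel. \<psi> x)" for n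
  proof -
    have i1: "integrable lborel \<psi>"
      by (rule integrable_continuous_compact_support[of "cball 0 B"])
         (use zero continuous_on_subset[OF cont] in auto)
    have "integrable lborel (\<lambda>x. \<psi> (t n *\<^sub>R x))"
    proof (rule integrable_continuous_compact_support[of "cball 0 B"])
      show "continuous_on (cball 0 B) (\<lambda>x. \<psi> (t n *\<^sub>R x))"
        by (intro continuous_on_compose2[OF cont] continuous_intros) auto
      show "\<psi> (t n *\<^sub>R x) = 0" if "x \<notin> cball 0 B" for x
        using that by (intro zero big) simp
    qed auto
    then have "(LINT x|lborel. Q n x) = ((LINT x|lborel. \<psi> (t n *\<^sub>R x)) - (LINT x|lborel. \<psi> x)) / (t n - 1)"
      unfolding Q_def using i1 by simp
    also have "(LINT x|lborel. \<psi> (t n *\<^sub>R x)) = (LINT x|lborel. \<psi> x) / t n ^ CARD('n)"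
      using t(1)[of n] by (subst integral_scaleR_arg[OF m]) auto
    finally show ?thesis by (simp add: field_simps)
  qed
  have "(\<lambda>n. (inverse (t n ^ CARD('n)) - 1) / (t n - 1)) \<longlonglongrightarrow> - real CARD('n)"
  proof -
    have "((\<lambda>s::real. inverse (s ^ CARD('n))) has_real_derivative - real CARD('n)) (at 1)"
      by (auto intro!: derivative_eq_intros)
    then have "((\<lambda>s::real. (inverse (s ^ CARD('n)) - 1) / (s - 1)) \<longlongrightarrow> - real CARD('n)) (at 1)"
      by (simp add: has_field_derivative_iff)
    then show ?thesis by (rule filterlim_compose[OF _ t_at])
  qed
  from tendsto_mult[OF this tendsto_const[of "LINT x|lborel. \<psi> x"]]
  have "(\<lambda>n. LINT x|lborel. Q n x) \<longlonglongrightarrow> - real CARD('n) * (LINT x|lborel. \<psi> x)"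
    unfolding Q_eq .
  with lim_int show ?thesis by (rule LIMSEQ_unique)
qed

lemma GDERIV_norm_powr:
  fixes x :: "'a::real_inner"
  assumes "x \<noteq> 0"
  shows "GDERIV (\<lambda>x. norm x powr a) x :> (a * norm x powr (a - 2)) *\<^sub>R x"
proof -
  have "((\<lambda>t. t powr a) has_real_derivative a * norm x powr (a - 1)) (at (norm x))"
    using assms by (intro has_real_derivative_powr) simp
  from GDERIV_DERIV_compose[OF GDERIV_norm[OF assms] this]
  have "GDERIV (\<lambda>x. norm x powr a) x :> (a * norm x powr (a - 1)) *\<^sub>R sgn x" .
  moreover have "norm x powr (a - 1) = norm x powr (a - 2) * norm x"
    using assms powr_add[of "norm x" "a - 2" 1] by simp
  moreover have "(a * norm x powr (a - 1)) *\<^sub>R sgn x = (a * norm x powr (a - 2)) *\<^sub>R x"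
    using assms \<open>norm x powr (a - 1) = _\<close> by (simp add: sgn_div_norm field_simps)
  ultimately show ?thesis by simp
qed

text \<open>Apply the previous identity to \<open>|x|\<^sup>-\<^sup>b \<phi>\<close>, which is again a test function because \<open>\<phi>\<close> vanishes
  near the origin. This is integration by parts against the field \<open>|x|\<^sup>-\<^sup>b x\<close>, whose divergence is
  \<open>(N - b) |x|\<^sup>-\<^sup>b\<close>; the fluxes of radial powers are multiples of such fields.\<close>

lemma integral_radial_power_field:
  fixes \<phi> :: "real ^ 'n \<Rightarrow> real"
  assumes \<phi>: "C1_compact_support S \<phi>" and "0 \<notin> S"
  shows "(LINT x|lborel. norm x powr (-b) * (x \<bullet> grad \<phi> x))
       = - (real CARD('n) - b) * (LINT x|lborel. norm x powr (-b) * \<phi> x)"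
proof -
  define K where "K = closure {x. \<phi> x \<noteq> 0}"
  have C1: "C1_on UNIV \<phi>" and K: "compact K" "0 \<notin> K"
    using assms by (auto simp: C1_compact_support_def K_def)
  note G = C1_on_GDERIV[OF C1 UNIV_I]
  have cont: "continuous_on A \<phi>" for A
    using C1_on_continuous[OF C1] continuous_on_subset by blast
  have cg: "continuous_on A (grad \<phi>)" for A
    using C1 continuous_on_subset by (fastforce simp: C1_on_def)
  note out = C1_compact_support_eq_0[OF \<phi>, folded K_def] C1_compact_support_grad_eq_0[OF \<phi>, folded K_def]
  define \<psi> where "\<psi> x = norm x powr (-b) * \<phi> x" for x
  define H where "H x = norm x powr (-b) *\<^sub>R grad \<phi> x - (b * norm x powr (-b-2) * \<phi> x) *\<^sub>R x" for x
  have H: "GDERIV \<psi> x :> H x" for x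
  proof (cases "x = 0")
    case True
    have "GDERIV \<psi> x :> 0"
    proof (rule GDERIV_cong_open[OF GDERIV_const[of 0]])
      show "x \<in> - K" using K True by simp
      show "\<psi> y = 0" if "y \<in> - K" for y using that out(1)[of y] by (simp add: \<psi>_def)
    qed (use K in \<open>auto intro: compact_imp_closed\<close>)
    then show ?thesis using True by (simp add: H_def)
  next
    case False
    from GDERIV_mult[OF GDERIV_norm_powr[OF False, of "-b"] G]
    have "GDERIV \<psi> x :> norm x powr (-b) *\<^sub>R grad \<phi> x + \<phi> x *\<^sub>R (- b * norm x powr (- b - 2)) *\<^sub>R x"
      unfolding \<psi>_def .
    moreover have "norm x powr (-b) *\<^sub>R grad \<phi> x + \<phi> x *\<^sub>R (- b * norm x powr (- b - 2)) *\<^sub>R x = H x"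
      by (simp add: H_def mult_ac)
    ultimately show ?thesis by simp
  qed
  have "continuous_on ((- {0}) \<union> (- K)) H"
  proof (rule continuous_on_open_Un)
    show "continuous_on (- {0}) H"
      unfolding H_def by (intro continuous_intros cont cg) auto
    have H0: "H x = 0" if "x \<in> - K" for x using that out[of x] by (simp add: H_def)
    show "continuous_on (- K) H"
      using continuous_on_cong[OF refl, of "- K" H "\<lambda>_. 0"] H0 by simp
  qed (use K in \<open>auto intro: compact_imp_closed\<close>)
  moreover have "(- {0}) \<union> (- K) = UNIV" using K by auto
  ultimately have "C1_compact_support UNIV \<psi>"
    using H K(1) out(1) by (intro C1_compact_supportI[where K = K and G = H]) (auto simp: \<psi>_def)
  from integral_euler_field[OF this]
  have "(LINT x|lborel. x \<bullet> H x) = - real CARD('n) * (LINT x|lborel. \<psi> x)"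
    using grad_eq[OF H] by simp
  moreover have  "x \<bullet> H x = norm x powr (-b) * (x \<bullet> grad \<phi> x) - b * \<psi> x" for x
  proof (cases "x = 0")
    case False
    have "norm x powr (-b-2) * (x \<bullet> x) = norm x powr (-b)"
      using False powr_add[of "norm x" "-b-2" 2] by (simp add: power2_norm_eq_inner)
    then show ?thesis by (simp add: H_def \<psi>_def inner_diff_right algebra_simps)
  qed (simp add: H_def \<psi>_def)
  moreover have "integrable lborel (\<lambda>x. norm x powr (-b) * (x \<bullet> grad \<phi> x))"
    using K out by (intro integrable_continuous_compact_support[OF K(1)] continuous_intros cont cg) auto
  moreover have "integrable lborel \<psi>"
    using K out unfolding \<psi>_def
    by (intro integrable_continuous_compact_support[OF K(1)] continuous_intros cont cg) auto
  ultimately have "(LINT x|lborel. norm x powr (-b) * (x \<bullet> grad \<phi> x)) - b * (LINT x|lborel. \<psi> x)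
      = - real CARD('n) * (LINT x|lborel. \<psi> x)"
    by simp
  then show ?thesis by (simp add: \<psi>_def[abs_def] left_diff_distrib)
qed

section \<open>The flux and the nonlinear terms\<close>

text \<open>By the Cauchy-Schwarz inequality the inner product is at least
  \<open>(|a|\<^sup>r\<^sup>-\<^sup>1 - |b|\<^sup>r\<^sup>-\<^sup>1) (|a| - |b|)\<close>, and \<open>t\<^sup>r\<^sup>-\<^sup>1\<close> is increasing.\<close>

lemma flux_monotone:
  fixes a b :: "real ^ 'n"
  assumes "1 < r"
  shows "0 \<le> (flux r a - flux r b) \<bullet> (a - b)"
proof -
  have pw: "norm x powr (r-2) * norm x = norm x powr (r-1)" for x :: "real^'n"
    using powr_add[of "norm x" "r-2" 1] by (cases "x = 0") auto
  have "(norm a powr (r-2) + norm b powr (r-2)) * (a \<bullet> b)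
      \<le> (norm a powr (r-2) + norm b powr (r-2)) * (norm a * norm b)"
    by (intro mult_left_mono norm_cauchy_schwarz) auto
  moreover have "0 \<le> (norm a powr (r-1) - norm b powr (r-1)) * (norm a - norm b)"
    using assms powr_mono2[of "r-1" "norm a" "norm b"] powr_mono2[of "r-1" "norm b" "norm a"]
    by (cases "norm a \<le> norm b") (auto intro: mult_nonneg_nonneg mult_nonpos_nonpos)
  moreover have "(flux r a - flux r b) \<bullet> (a - b)
    = norm a powr (r-2) * norm a * norm a + norm b powr (r-2) * norm b * norm b
      - (norm a powr (r-2) + norm b powr (r-2)) * (a \<bullet> b)"
    by (simp add: flux_def algebra_simps inner_commute flip: power2_norm_eq_inner)
       (simp add: power2_eq_square)
  moreover have "(norm a powr (r-1) - norm b powr (r-1)) * (norm a - norm b)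
    = norm a powr (r-2) * norm a * norm a + norm b powr (r-2) * norm b * norm b
      - (norm a powr (r-2) + norm b powr (r-2)) * (norm a * norm b)"
    by (simp add: pw[symmetric] algebra_simps)
  ultimately show ?thesis by linarith
qed

lemma norm_flux: "norm (flux r x) = norm x powr (r - 1)"
  using powr_add[of "norm x" "r-2" 1] by (cases "x = 0") (auto simp: flux_def)

lemma continuous_on_flux:
  assumes "1 < r"
  shows "continuous_on A (flux r :: real^'n \<Rightarrow> real^'n)"
proof -
  have "isCont (flux r) x" for x :: "real^'n"
  proof (cases "x = 0")
    case True
    have "((\<lambda>y::real^'n. norm y powr (r - 1)) \<longlongrightarrow> norm (0::real^'n) powr (r - 1)) (at 0)"
      using assms by (intro tendsto_powr' tendsto_intros) auto
    then have "((\<lambda>y::real^'n. norm (flux r y)) \<longlongrightarrow> 0) (at 0)"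
      using assms by (simp add: norm_flux)
    then have "(flux r \<longlongrightarrow> (0::real^'n)) (at 0)"
      by (rule tendsto_norm_zero_cancel)
    then show ?thesis using True by (simp add: isCont_def flux_def[of r "0::real^'n"])
  next
    case False
    then show ?thesis unfolding flux_def by (intro continuous_intros) auto
  qed
  then show ?thesis by (simp add: continuous_at_imp_continuous_on)
qed

text \<open>Squaring the positive part removes its corner. Test functions built from it are therefore of
  class \<open>C\<^sup>1\<close> and admissible in the weak formulation.\<close>

lemma DERIV_pos_part_square: "((\<lambda>t. (max 0 t)\<^sup>2) has_real_derivative 2 * max 0 t) (at t)" for t :: real
proof -
  consider "t < 0" | "t > 0" | "t = 0" by linarith
  then show ?thesis
  proof cases
    case 1
    have "((\<lambda>t. 0) has_real_derivative 2 * max 0 t) (at t)" using 1 by simp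
    then show ?thesis
      by (rule has_field_derivative_transform_within_open[of _ _ _ "{..<0}"]) (use 1 in auto)
  next
    case 2
    have "((\<lambda>t. t\<^sup>2) has_real_derivative 2 * max 0 t) (at t)"
      using 2 by (auto intro!: derivative_eq_intros)
    then show ?thesis
      by (rule has_field_derivative_transform_within_open[of _ _ _ "{0<..}"]) (use 2 in auto)
  next
    case 3
    have "((\<lambda>y::real. max 0 y) \<longlongrightarrow> max 0 0) (at 0)" by (intro tendsto_intros)
    moreover have "(\<lambda>y::real. (max 0 y)\<^sup>2 / y) = (\<lambda>y. max 0 y)"
      by (auto simp: fun_eq_iff max_def power2_eq_square)
    ultimately show ?thesis using 3 by (simp add: has_field_derivative_iff)
  qed
qed

lemma continuous_on_npow:
  assumes "continuous_on A f" "\<And>x. x \<in> A \<Longrightarrow> 0 \<le> f x" "0 \<le> a"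
  shows "continuous_on A (\<lambda>x. npow (f x) a)"
  using assms by (cases "a = 0") (auto simp: npow_def intro!: continuous_on_powr')

lemma npow_nonneg: "0 \<le> npow t a"
  by (simp add: npow_def)

lemma npow_eq_powr: "0 < t \<Longrightarrow> npow t a = t powr a"
  by (simp add: npow_def)

section \<open>Comparison from below\<close>

text \<open>If \<open>w = v - u\<close> had a positive maximum, it would be attained inside \<open>U\<close>, and there
  \<open>grad u = V\<close>, so \<open>d < u\<^sup>s |grad u|\<^sup>m\<close> on the set of maximum points. By compactness the strict
  inequality persists on a superlevel set \<open>{w \<ge> c}\<close> with \<open>c\<close> slightly below the maximum. Testing with
  \<open>((w - c)\<^sup>+)\<^sup>2\<close>, monotonicity of the flux bounds the integral of
  \<open>(u\<^sup>s |grad u|\<^sup>m - d) ((w - c)\<^sup>+)\<^sup>2\<close> from above by zero, although the integrand is positive near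
  the maximum.

  The inequality for \<open>d\<close> is only required where the two gradients agree. This makes it possible to
  evaluate the gradient term of the inequality on the barrier.\<close>

lemma weak_comparison:
  fixes u v d :: "real ^ 'n \<Rightarrow> real" and V :: "real ^ 'n \<Rightarrow> real ^ 'n"
  assumes exps: "1 < p" "1 < q" "0 \<le> s" "0 \<le> m"
    and sol: "pq_solution p q s m \<Omega> u"
    and A: "compact A" "A \<subseteq> \<Omega>" and U: "open U" "U \<subseteq> A"
    and dv: "\<And>x. x \<in> A \<Longrightarrow> GDERIV v x :> V x"
    and cV: "continuous_on A V" and cd: "continuous_on A d"
    and boundary: "\<And>x. x \<in> A - U \<Longrightarrow> v x \<le> u x"
    and weak: "\<And>\<phi>. C1_compact_support U \<phi> \<Longrightarrow>
      (LINT x:A|lborel. (flux p (V x) + flux q (V x)) \<bullet> grad \<phi> x) = (LINT x:A|lborel. d x * \<phi> x)"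
    and touch: "\<And>x. x \<in> U \<Longrightarrow> grad u x = V x \<Longrightarrow>
      d x < npow (u x) s * npow (norm (grad u x)) m"
    and "x \<in> A"
  shows "v x \<le> u x"
proof (rule ccontr)
  assume "\<not> v x \<le> u x"
  define F where "F x = npow (u x) s * npow (norm (grad u x)) m" for x
  define w where "w x = v x - u x" for x
  have C1u: "C1_on \<Omega> u" and u0: "\<And>x. x \<in> \<Omega> \<Longrightarrow> 0 \<le> u x"
    using sol by (auto simp: pq_solution_def)
  have cu: "continuous_on A u"
    using C1_on_continuous[OF C1u] A(2) continuous_on_subset by blast
  have cgu: "continuous_on A (grad u)"
    using C1u A(2) continuous_on_subset unfolding C1_on_def by blast
  have cv: "continuous_on A v"
    using dv GDERIV_imp_isCont by (blast intro: continuous_at_imp_continuous_on)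
  have cw: "continuous_on A w" unfolding w_def by (intro continuous_intros cu cv)
  have cF: "continuous_on A F" unfolding F_def
    by (intro continuous_intros continuous_on_npow cu cgu exps) (use u0 A in auto)
  have dw: "GDERIV w x :> V x - grad u x" if "x \<in> A" for x
    unfolding w_def using that A(2) by (intro GDERIV_diff dv C1_on_GDERIV[OF C1u]) auto
  obtain x0 where x0: "x0 \<in> A" "\<And>y. y \<in> A \<Longrightarrow> w y \<le> w x0"
    using continuous_attains_sup[OF A(1) _ cw] \<open>x \<in> A\<close> by blast
  have M: "w x0 > 0"
    using x0(2)[OF \<open>x \<in> A\<close>] \<open>\<not> v x \<le> u x\<close> by (simp add: w_def)
  have inner: "y \<in> U" if "y \<in> A" "w y > 0" for y
    using boundary[of y] that by (force simp: w_def)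
  have max_touch: "d y < F y" if "y \<in> A" "w y = w x0" for y
  proof -
    have y: "y \<in> U" using inner that M by simp
    have "(\<lambda>h. h \<bullet> (V y - grad u y)) = (\<lambda>h. 0)"
      using y U that x0(2)
      by (intro differential_zero_maxmin[OF y U(1) dw[OF that(1), unfolded gderiv_def]]) auto
    then have "(V y - grad u y) \<bullet> (V y - grad u y) = 0" by metis
    then show ?thesis using touch[OF y] by (simp add: F_def)
  qed
  \<comment> \<open>The set \<open>B\<close> where the strict inequality fails is compact and contains no maximum point, so \<open>w\<close>
    stays away from its maximum on it; \<open>c\<close> lies between the two values.\<close>
  obtain c where c: "0 < c" "c < w x0" "\<And>y. y \<in> A \<Longrightarrow> F y \<le> d y \<Longrightarrow> w y < c"
  proof -
    define B where "B = A \<inter> (\<lambda>y. F y - d y) -` {..0}"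
    have "closed B" unfolding B_def
      by (intro continuous_closed_preimage continuous_intros cF cd compact_imp_closed A(1) closed_atMost)
    then have "compact B"
      using compact_Int_closed[OF A(1), of B] by (simp add: B_def Int_absorb1 Int_absorb2)
    show ?thesis
    proof (cases "B = {}")
      case True
      then show ?thesis using M by (intro that[of "w x0 / 2"]) (auto simp: B_def)
    next
      case False
      have "continuous_on B w"
        by (rule continuous_on_subset[OF cw]) (simp add: B_def)
      then obtain b where b: "b \<in> B" "\<And>y. y \<in> B \<Longrightarrow> w y \<le> w b"
        using continuous_attains_sup[OF \<open>compact B\<close> False] by blast
      have "w b \<noteq> w x0" using max_touch[of b] b(1) by (auto simp: B_def)
      moreover have "w b \<le> w x0" using x0(2) b(1) by (simp add: B_def)
      ultimately have "max 0 (w b) < w x0" using M by simp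
      then obtain c where c: "max 0 (w b) < c" "c < w x0" using dense by blast
      show ?thesis
      proof (rule that[of c])
        show "w y < c" if "y \<in> A" "F y \<le> d y" for y
          using b(2)[of y] that c by (simp add: B_def)
      qed (use c in auto)
    qed
  qed
  define K where "K = A \<inter> w -` {c..}"
  have "closed K" unfolding K_def
    by (intro continuous_closed_preimage cw compact_imp_closed A(1) closed_atLeast)
  then have K: "compact K" "K \<subseteq> U"
    using compact_Int_closed[OF A(1), of K] inner c(1) by (auto simp: K_def Int_absorb1 Int_absorb2)
  define \<phi> where "\<phi> x = (if x \<in> A then (max 0 (w x - c))\<^sup>2 else 0)" for x
  define G where "G x = (if x \<in> A then (2 * max 0 (w x - c)) *\<^sub>R (V x - grad u x) else 0)" for x
  have off: "\<phi> y = 0" "G y = 0" if "y \<notin> K" for y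
    using that by (auto simp: \<phi>_def G_def K_def)
  have opK: "open (- K)" using \<open>closed K\<close> by (simp add: open_Compl)
  have G: "GDERIV \<phi> y :> G y" for y
  proof (cases "y \<in> K")
    case True
    then have y: "y \<in> U" "y \<in> A" using K U by auto
    have "GDERIV (\<lambda>x. w x - c) y :> V y - grad u y"
      using GDERIV_diff[OF dw[OF y(2)] GDERIV_const[of c]] by simp
    from GDERIV_DERIV_compose[OF this DERIV_pos_part_square]
    have "GDERIV (\<lambda>x. (max 0 (w x - c))\<^sup>2) y :> G y"
      using y by (simp add: G_def)
    then show ?thesis
      by (rule GDERIV_cong_open[OF _ U(1) y(1)]) (use U(2) in \<open>auto simp: \<phi>_def\<close>)
  next
    case False
    have "GDERIV \<phi> y :> 0"
      by (rule GDERIV_cong_open[OF GDERIV_const[of 0] opK]) (use False off in auto)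
    then show ?thesis using off(2)[OF False] by simp
  qed
  have "continuous_on (U \<union> - K) G"
  proof (rule continuous_on_open_Un[OF U(1) opK])
    have "continuous_on A (\<lambda>x. (2 * max 0 (w x - c)) *\<^sub>R (V x - grad u x))"
      by (intro continuous_intros cw cV cgu)
    then have "continuous_on A G"
      using continuous_on_cong[OF refl, of A G "\<lambda>x. (2 * max 0 (w x - c)) *\<^sub>R (V x - grad u x)"]
      by (simp add: G_def)
    then show "continuous_on U G" using U(2) continuous_on_subset by blast
    show "continuous_on (- K) G"
      using continuous_on_cong[OF refl, of "- K" G "\<lambda>_. 0"] off(2) by simp
  qed
  moreover have "U \<union> - K = UNIV" using K by auto
  ultimately have cG: "continuous_on UNIV G" by simp
  have test: "C1_compact_support S \<phi>" if "U \<subseteq> S" for S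
    by (rule C1_compact_supportI[OF G cG K(1)]) (use K(2) that off in auto)
  have grad: "grad \<phi> = G" using G grad_eq by blast
  have c\<phi>: "continuous_on A \<phi>"
    using C1_on_continuous test[of UNIV] continuous_on_subset
    unfolding C1_compact_support_def by blast
  have cGA: "continuous_on A G" using cG continuous_on_subset by blast
  have \<phi>0: "0 \<le> \<phi> y" for y by (simp add: \<phi>_def)
  have restrict: "(LINT x:\<Omega>|lborel. f x) = (LINT x:A|lborel. f x)"
    if "\<And>y. y \<notin> A \<Longrightarrow> f y = 0" for f :: "real^'n \<Rightarrow> real"
  proof -
    have "(\<lambda>x. indicator \<Omega> x *\<^sub>R f x) = (\<lambda>x. indicator A x *\<^sub>R f x)"
      using that A(2) by (auto simp: fun_eq_iff indicator_def)
    then show ?thesis by (simp add: set_lebesgue_integral_def)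
  qed
  have int: "set_integrable lborel A f" if "continuous_on A f" for f :: "real^'n \<Rightarrow> real"
    unfolding set_integrable_def by (rule borel_integrable_compact[OF A(1) that])
  have cflux: "continuous_on A (\<lambda>x. flux r (V x))" "continuous_on A (\<lambda>x. flux r (grad u x))" if "1 < r" for r
    using continuous_on_compose2[OF continuous_on_flux[OF that]] cV cgu by blast+
  have "(LINT x:\<Omega>|lborel. flux p (grad u x) \<bullet> grad \<phi> x) + (LINT x:\<Omega>|lborel. flux q (grad u x) \<bullet> grad \<phi> x)
        \<ge> (LINT x:\<Omega>|lborel. npow (u x) s * npow (norm (grad u x)) m * \<phi> x)"
    using sol test[of \<Omega>] \<phi>0 U(2) A(2) unfolding pq_solution_def by blast
  then have ineq: "(LINT x:A|lborel. flux p (grad u x) \<bullet> G x) + (LINT x:A|lborel. flux q (grad u x) \<bullet> G x)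
        \<ge> (LINT x:A|lborel. F x * \<phi> x)"
    unfolding grad F_def[symmetric] by (subst (asm) (1 2 3) restrict) (auto simp: \<phi>_def G_def)
  have "(LINT x:A|lborel. (F x - d x) * \<phi> x) = (LINT x:A|lborel. F x * \<phi> x) - (LINT x:A|lborel. d x * \<phi> x)"
    by (subst set_integral_diff(2)[symmetric])
       (auto intro!: int continuous_intros cF c\<phi> cd simp: algebra_simps)
  also have "(LINT x:A|lborel. d x * \<phi> x) = (LINT x:A|lborel. (flux p (V x) + flux q (V x)) \<bullet> G x)"
    using weak[OF test] grad by simp
  also have "(LINT x:A|lborel. F x * \<phi> x) - (LINT x:A|lborel. (flux p (V x) + flux q (V x)) \<bullet> G x)
      \<le> (LINT x:A|lborel. flux p (grad u x) \<bullet> G x) + (LINT x:A|lborel. flux q (grad u x) \<bullet> G x)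
        - (LINT x:A|lborel. (flux p (V x) + flux q (V x)) \<bullet> G x)"
    using ineq by simp
  also have "\<dots> = (LINT x:A|lborel. flux p (grad u x) \<bullet> G x + flux q (grad u x) \<bullet> G x
        - (flux p (V x) + flux q (V x)) \<bullet> G x)"
    by (subst set_integral_diff(2) set_integral_add(2);
        (intro set_integral_add(1) int continuous_intros cflux cGA exps)?)+ simp
  also have "\<dots> \<le> (LINT x:A|lborel. 0)"
  proof (rule set_integral_mono)
    fix y assume y: "y \<in> A"
    have "flux p (grad u y) \<bullet> G y + flux q (grad u y) \<bullet> G y - (flux p (V y) + flux q (V y)) \<bullet> G y
      = - (2 * max 0 (w y - c)) * ((flux p (V y) - flux p (grad u y)) \<bullet> (V y - grad u y)
          + (flux q (V y) - flux q (grad u y)) \<bullet> (V y - grad u y))"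
      using y by (simp add: G_def inner_diff_left inner_add_left algebra_simps)
    also have "\<dots> \<le> 0"
      using flux_monotone[OF exps(1), of "V y" "grad u y"] flux_monotone[OF exps(2), of "V y" "grad u y"]
      by (intro mult_nonpos_nonneg) auto
    finally show "flux p (grad u y) \<bullet> G y + flux q (grad u y) \<bullet> G y - (flux p (V y) + flux q (V y)) \<bullet> G y \<le> 0" .
  qed (intro int continuous_intros cflux cGA exps)+
  finally have le0: "(LINT x:A|lborel. (F x - d x) * \<phi> x) \<le> 0" by simp
  \<comment> \<open>The integral of the non-negative function \<open>f\<close> is at most zero, so \<open>f\<close> vanishes almost everywhere,
    but it is positive on a neighbourhood \<open>S\<close> of \<open>x0\<close>.\<close>
  define f where "f x = indicator A x *\<^sub>R ((F x - d x) * \<phi> x)" for x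
  have f0: "0 \<le> f y" for y
  proof (cases "y \<in> K")
    case True
    then have "d y < F y" using c(3)[of y] by (force simp: K_def)
    then show ?thesis using \<phi>0[of y] by (simp add: f_def indicator_def)
  qed (simp add: f_def off)
  have fi: "integrable lborel f"
    unfolding f_def by (intro int[unfolded set_integrable_def] continuous_intros cF cd c\<phi>)
  have "integral\<^sup>L lborel f = 0"
    using le0 integral_nonneg_AE[of f lborel] f0 by (simp add: f_def[abs_def] set_lebesgue_integral_def)
  then have "AE y in lborel. f y = 0"
    using integral_nonneg_eq_0_iff_AE[OF fi] f0 by simp
  then have ae: "AE y in lebesgue. f y = 0" by (rule AE_completion)
  define S where "S = U \<inter> w -` {c<..}"
  have "open S" unfolding S_def
    by (intro continuous_open_preimage continuous_on_subset[OF cw] U open_greaterThan)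
  have f_pos: "f y \<noteq> 0" if "y \<in> S" for y
  proof -
    have y: "y \<in> A" "w y > c" using that U by (auto simp: S_def)
    then have "d y < F y" using c(3)[of y] by force
    then show ?thesis using y by (simp add: f_def \<phi>_def)
  qed
  have "AE y \<in> S in lebesgue. y \<in> {}"
    using ae by (rule eventually_mono) (use f_pos in auto)
  moreover have "x0 \<in> S" using inner x0(1) M c by (simp add: S_def)
  ultimately show False
    using mem_closed_if_AE_lebesgue_open[OF \<open>open S\<close>, of "{}" x0] by simp
qed

section \<open>Power barriers\<close>

text \<open>The value of \<open>-\<Delta>\<^sub>t (k |x|\<^sup>-\<^sup>\<gamma>)\<close> in \<open>\<real>\<^sup>N\<close> at \<open>|x| = r\<close>.\<close>

definition neg_laplace_power :: "real \<Rightarrow> real \<Rightarrow> real \<Rightarrow> real \<Rightarrow> real \<Rightarrow> real" where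
  "neg_laplace_power N t k \<gamma> r =
     (k * \<gamma>) powr (t - 1) * (N - ((\<gamma> + 1) * (t - 1) + 1)) * r powr (- ((\<gamma> + 1) * (t - 1) + 1))"

text \<open>The constant \<open>a\<close> shifts the power so that it vanishes on an outer sphere.\<close>

lemma GDERIV_power_barrier:
  fixes x :: "'a::real_inner"
  assumes "x \<noteq> 0"
  shows "GDERIV (\<lambda>x. k * (norm x powr (-\<gamma>) - a)) x :> - (k * \<gamma> * norm x powr (-\<gamma>-2)) *\<^sub>R x"
proof -
  have "GDERIV (\<lambda>x. k * (norm x powr (-\<gamma>) - a)) x
      :> k *\<^sub>R ((- \<gamma> * norm x powr (-\<gamma>-2)) *\<^sub>R x - 0) + (norm x powr (-\<gamma>) - a) *\<^sub>R 0"
    by (intro GDERIV_mult GDERIV_const GDERIV_diff GDERIV_norm_powr assms)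
  then show ?thesis by (rule GDERIV_subst) (simp add: mult_ac)
qed

lemma norm_grad_power_barrier:
  fixes x :: "'a::real_normed_vector"
  assumes "x \<noteq> 0" "0 < k" "0 < \<gamma>"
  shows "norm (- (k * \<gamma> * norm x powr (-\<gamma>-2)) *\<^sub>R x) = k * \<gamma> * norm x powr (- (\<gamma> + 1))"
proof -
  have e: "- (\<gamma> + 1) = (-\<gamma>-2) + 1" by simp
  show ?thesis unfolding e powr_add using assms by (simp add: abs_mult)
qed

lemma flux_power_barrier:
  fixes x :: "real ^ 'n"
  assumes "x \<noteq> 0" "0 < k" "0 < \<gamma>"
  shows "flux t (- (k * \<gamma> * norm x powr (-\<gamma>-2)) *\<^sub>R x)
    = - ((k * \<gamma>) powr (t - 1) * norm x powr (- ((\<gamma> + 1) * (t - 1) + 1))) *\<^sub>R x"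
proof -
  have n: "(k * \<gamma> * norm x powr (- (\<gamma> + 1))) powr (t - 2)
      = (k * \<gamma>) powr (t - 2) * norm x powr (- (\<gamma> + 1) * (t - 2))"
    using assms by (simp add: powr_mult powr_powr)
  have c: "(k * \<gamma>) powr (t - 2) * (k * \<gamma>) = (k * \<gamma>) powr (t - 1)"
    using assms powr_add[of "k * \<gamma>" "t - 2" 1] by simp
  have r: "norm x powr (- (\<gamma> + 1) * (t - 2)) * norm x powr (-\<gamma>-2)
      = norm x powr (- ((\<gamma> + 1) * (t - 1) + 1))"
    by (simp add: powr_add[symmetric] algebra_simps)
  have "(k * \<gamma> * norm x powr (- (\<gamma> + 1))) powr (t - 2) * (k * \<gamma> * norm x powr (-\<gamma>-2))
      = ((k * \<gamma>) powr (t - 2) * (k * \<gamma>)) * (norm x powr (- (\<gamma> + 1) * (t - 2)) * norm x powr (-\<gamma>-2))"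
    unfolding n by (simp only: mult_ac)
  also have "\<dots> = (k * \<gamma>) powr (t - 1) * norm x powr (- ((\<gamma> + 1) * (t - 1) + 1))"
    unfolding c r ..
  finally have "(k * \<gamma> * norm x powr (- (\<gamma> + 1))) powr (t - 2) * (k * \<gamma> * norm x powr (-\<gamma>-2))
      = (k * \<gamma>) powr (t - 1) * norm x powr (- ((\<gamma> + 1) * (t - 1) + 1))" .
  then show ?thesis
    unfolding flux_def norm_grad_power_barrier[OF assms] by simp
qed

lemma weak_neg_laplace_power:
  fixes \<phi> :: "real ^ 'n \<Rightarrow> real"
  assumes \<phi>: "C1_compact_support U \<phi>" and U: "U \<subseteq> A" "0 \<notin> A" and pos: "0 < k" "0 < \<gamma>"
  shows "(LINT x:A|lborel. flux t (- (k * \<gamma> * norm x powr (-\<gamma>-2)) *\<^sub>R x) \<bullet> grad \<phi> x)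
    = (LINT x:A|lborel. neg_laplace_power (real CARD('n)) t k \<gamma> (norm x) * \<phi> x)"
proof -
  define b where "b = (\<gamma> + 1) * (t - 1) + 1"
  have off: "\<phi> x = 0" "grad \<phi> x = 0" if "x \<notin> A" for x
    using C1_compact_support_eq_0[OF \<phi>, of x] C1_compact_support_grad_eq_0[OF \<phi>, of x] that U \<phi>
    unfolding C1_compact_support_def by blast+
  have l: "indicator A x *\<^sub>R (flux t (- (k * \<gamma> * norm x powr (-\<gamma>-2)) *\<^sub>R x) \<bullet> grad \<phi> x)
      = - ((k * \<gamma>) powr (t - 1)) * (norm x powr (-b) * (x \<bullet> grad \<phi> x))" for x
  proof (cases "x \<in> A")
    case True
    have "x \<noteq> 0" using True U by auto
    show ?thesis
      unfolding flux_power_barrier[OF \<open>x \<noteq> 0\<close> pos] using True by (simp add: b_def)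
  qed (simp add: off)
  have r: "indicator A x *\<^sub>R (neg_laplace_power (real CARD('n)) t k \<gamma> (norm x) * \<phi> x)
      = (k * \<gamma>) powr (t - 1) * (real CARD('n) - b) * (norm x powr (-b) * \<phi> x)" for x
    by (cases "x \<in> A") (simp_all add: off neg_laplace_power_def b_def)
  have "0 \<notin> U" using U by blast
  then show ?thesis
    unfolding set_lebesgue_integral_def l r integral_mult_right_zero
      integral_radial_power_field[OF \<phi> \<open>0 \<notin> U\<close>, of b]
    by (simp add: algebra_simps)
qed

text \<open>Compare \<open>u\<close> on the annulus \<open>R \<le> |x| \<le> \<rho>\<close> with \<open>k (|x|\<^sup>-\<^sup>\<gamma> - \<rho>\<^sup>-\<^sup>\<gamma>)\<close> and let \<open>\<rho>\<close> tend to
  infinity. Subtracting the constant makes the barrier vanish on the outer sphere, where nothing but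
  \<open>u \<ge> 0\<close> is known, and leaves its gradient unchanged.\<close>

lemma power_barrier:
  fixes u :: "real ^ 'n \<Rightarrow> real"
  assumes exps: "1 < p" "1 < q" "0 \<le> s" "0 \<le> m"
    and sol: "pq_solution p q s m \<Omega> u" and ext: "{x. R \<le> norm x} \<subseteq> \<Omega>"
    and pos: "0 < R" "0 < k" "0 < \<gamma>"
    and sphere: "\<And>x. norm x = R \<Longrightarrow> k * R powr (-\<gamma>) \<le> u x"
    and touch: "\<And>x. R < norm x \<Longrightarrow> grad u x = - (k * \<gamma> * norm x powr (-\<gamma>-2)) *\<^sub>R x \<Longrightarrow>
      neg_laplace_power (real CARD('n)) p k \<gamma> (norm x) + neg_laplace_power (real CARD('n)) q k \<gamma> (norm x)
        < npow (u x) s * npow (norm (grad u x)) m"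
    and x: "R \<le> norm x"
  shows "k * norm x powr (-\<gamma>) \<le> u x"
proof -
  let ?D = "\<lambda>t x::real^'n. neg_laplace_power (real CARD('n)) t k \<gamma> (norm x)"
  have *: "k * (norm x powr (-\<gamma>) - \<rho> powr (-\<gamma>)) \<le> u x" if \<rho>: "norm x < \<rho>" for \<rho>
  proof (rule weak_comparison[OF exps sol])
    let ?A = "{x::real^'n. R \<le> norm x \<and> norm x \<le> \<rho>}" and ?U = "{x::real^'n. R < norm x \<and> norm x < \<rho>}"
    let ?V = "\<lambda>x. - (k * \<gamma> * norm x powr (-\<gamma>-2)) *\<^sub>R x"
    have nz: "y \<noteq> 0" if "y \<in> ?A" for y using that pos by auto
    have "?A = cball 0 \<rho> - ball 0 R" by (auto simp: dist_norm)
    then show A: "compact ?A" by (simp add: compact_diff)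
    show "?A \<subseteq> \<Omega>" using ext by auto
    show "open ?U" by (intro open_Collect_conj open_Collect_less continuous_intros)
    show "?U \<subseteq> ?A" by auto
    show "GDERIV (\<lambda>x. k * (norm x powr (-\<gamma>) - \<rho> powr (-\<gamma>))) y :> ?V y" if "y \<in> ?A" for y
      by (rule GDERIV_power_barrier[OF nz[OF that]])
    show cV: "continuous_on ?A ?V"
      by (intro continuous_intros) (use nz in auto)
    have cD: "continuous_on ?A (?D t)" for t
      unfolding neg_laplace_power_def by (intro continuous_intros) (use nz in auto)
    then show "continuous_on ?A (\<lambda>x. ?D p x + ?D q x)" by (intro continuous_intros)
    show "x \<in> ?A" using x \<rho> by simp
    show "k * (norm y powr (-\<gamma>) - \<rho> powr (-\<gamma>)) \<le> u y" if "y \<in> ?A - ?U" for y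
    proof (cases "norm y = R")
      case True
      have "k * (norm y powr (-\<gamma>) - \<rho> powr (-\<gamma>)) \<le> k * R powr (-\<gamma>)"
        using True pos by (intro mult_left_mono) auto
      then show ?thesis using sphere[OF True] by simp
    next
      case False
      then have "norm y = \<rho>" using that by auto
      moreover have "0 \<le> u y" using sol ext that unfolding pq_solution_def by auto
      ultimately show ?thesis by simp
    qed
    show "?D p y + ?D q y < npow (u y) s * npow (norm (grad u y)) m"
      if "y \<in> ?U" "grad u y = ?V y" for y
      using touch that by blast
    fix \<phi> assume \<phi>: "C1_compact_support ?U \<phi>"
    have C1: "C1_on UNIV \<phi>" using \<phi> by (simp add: C1_compact_support_def)
    have c\<phi>: "continuous_on ?A \<phi>" using C1_on_continuous[OF C1] continuous_on_subset by blast
    have cg: "continuous_on ?A (grad \<phi>)" using C1 continuous_on_subset unfolding C1_on_def by blast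
    have int: "set_integrable lborel ?A f" if "continuous_on ?A f" for f :: "real^'n \<Rightarrow> real"
      unfolding set_integrable_def by (rule borel_integrable_compact[OF A that])
    have cflux: "continuous_on ?A (\<lambda>x. flux t (?V x) \<bullet> grad \<phi> x)" if "1 < t" for t
      by (intro continuous_on_inner cg continuous_on_compose2[OF continuous_on_flux[OF that, of UNIV] cV]) auto
    have one: "(LINT x:?A|lborel. flux t (?V x) \<bullet> grad \<phi> x) = (LINT x:?A|lborel. ?D t x * \<phi> x)" for t
      by (rule weak_neg_laplace_power[OF \<phi>]) (use pos in auto)
    have "(LINT x:?A|lborel. (flux p (?V x) + flux q (?V x)) \<bullet> grad \<phi> x)
      = (LINT x:?A|lborel. flux p (?V x) \<bullet> grad \<phi> x) + (LINT x:?A|lborel. flux q (?V x) \<bullet> grad \<phi> x)"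
      unfolding inner_add_left by (intro set_integral_add(2) int cflux exps)
    also have "\<dots> = (LINT x:?A|lborel. ?D p x * \<phi> x) + (LINT x:?A|lborel. ?D q x * \<phi> x)"
      unfolding one ..
    also have "\<dots> = (LINT x:?A|lborel. (?D p x + ?D q x) * \<phi> x)"
      unfolding distrib_right
      by (intro set_integral_add(2)[symmetric] int continuous_on_mult cD c\<phi>)
    finally show "(LINT x:?A|lborel. (flux p (?V x) + flux q (?V x)) \<bullet> grad \<phi> x)
      = (LINT x:?A|lborel. (?D p x + ?D q x) * \<phi> x)" .
  qed
  have "((\<lambda>\<rho>. \<rho> powr (-\<gamma>)) \<longlongrightarrow> 0) at_top"
    using pos by (intro tendsto_neg_powr filterlim_ident) simp
  then have "((\<lambda>\<rho>. k * (norm x powr (-\<gamma>) - \<rho> powr (-\<gamma>))) \<longlongrightarrow> k * (norm x powr (-\<gamma>) - 0)) at_top"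
    by (intro tendsto_intros)
  moreover have "\<forall>\<^sub>F \<rho> in at_top. k * (norm x powr (-\<gamma>) - \<rho> powr (-\<gamma>)) \<le> u x"
    using eventually_gt_at_top[of "norm x"] by eventually_elim (rule *)
  ultimately show ?thesis
    using tendsto_upperbound[of _ _ at_top "u x"] by force
qed

text \<open>Only the behaviour near infinity is recorded; the constant may change from one exponent to the
  next.\<close>

definition decays_at_most :: "real \<Rightarrow> (real ^ 'n \<Rightarrow> real) \<Rightarrow> bool" where
  "decays_at_most \<gamma> u \<longleftrightarrow> (\<exists>c>0. \<forall>\<^sub>F x in at_infinity. c * norm x powr (-\<gamma>) \<le> u x)"

text \<open>The radius \<open>R\<close> is fixed first, from the strict differential inequality, and only then the
  amplitude \<open>k\<close>, small enough for the barrier to stay below the minimum of \<open>u\<close> on the sphere of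
  radius \<open>R\<close>. For this order of choices the differential inequality has to hold uniformly for
  small \<open>k\<close>.\<close>

lemma decays_at_most_barrier:
  fixes u :: "real ^ 'n \<Rightarrow> real"
  assumes exps: "1 < p" "1 < q" "0 \<le> s" "0 \<le> m"
    and sol: "pq_solution p q s m \<Omega> u" and ext: "exterior_domain \<Omega>"
    and upos: "\<And>x. x \<in> \<Omega> \<Longrightarrow> 0 < u x"
    and pos: "0 < k0" "0 < \<gamma>"
    and touch: "\<forall>\<^sub>F x in at_infinity. \<forall>k. 0 < k \<and> k \<le> k0 \<and>
        grad u x = - (k * \<gamma> * norm x powr (-\<gamma>-2)) *\<^sub>R x \<longrightarrow>
      neg_laplace_power (real CARD('n)) p k \<gamma> (norm x) + neg_laplace_power (real CARD('n)) q k \<gamma> (norm x)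
        < npow (u x) s * npow (norm (grad u x)) m"
  shows "decays_at_most \<gamma> u"
proof -
  obtain R0 where R0: "0 < R0" "{x. norm x > R0} \<subseteq> \<Omega>"
    using ext by (auto simp: exterior_domain_def)
  obtain R1 where R1: "\<And>x k. R1 \<le> norm x \<Longrightarrow> 0 < k \<Longrightarrow> k \<le> k0 \<Longrightarrow>
        grad u x = - (k * \<gamma> * norm x powr (-\<gamma>-2)) *\<^sub>R x \<Longrightarrow>
      neg_laplace_power (real CARD('n)) p k \<gamma> (norm x) + neg_laplace_power (real CARD('n)) q k \<gamma> (norm x)
        < npow (u x) s * npow (norm (grad u x)) m"
    using touch unfolding eventually_at_infinity by blast
  define R where "R = max R1 (R0 + 1)"
  have R: "0 < R" "R1 \<le> R" "R0 < R" using R0 by (auto simp: R_def)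
  have ext': "{x. R \<le> norm x} \<subseteq> \<Omega>" using R0 R by auto
  have "C1_on \<Omega> u" using sol by (simp add: pq_solution_def)
  then have "continuous_on (sphere 0 R) u"
    using C1_on_continuous ext' continuous_on_subset by (metis (no_types, lifting) dual_order.refl
      mem_Collect_eq mem_sphere_0 subset_iff)
  moreover have "sphere (0::real^'n) R \<noteq> {}" using R by simp
  ultimately obtain z where z: "z \<in> sphere 0 R" "\<And>y. y \<in> sphere 0 R \<Longrightarrow> u z \<le> u y"
    using continuous_attains_inf[OF compact_sphere, of "0::real^'n" R u] by blast
  have uz: "0 < u z" using z(1) ext' upos by auto
  define k where "k = min k0 (u z * R powr \<gamma>)"
  have k: "0 < k" "k \<le> k0" "k * R powr (-\<gamma>) \<le> u z"
    using pos uz R by (auto simp: k_def powr_minus field_simps)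
  have "k * norm x powr (-\<gamma>) \<le> u x" if "R \<le> norm x" for x
  proof (rule power_barrier[OF exps sol ext' R(1) k(1) pos(2) _ _ that])
    show "k * R powr (-\<gamma>) \<le> u y" if "norm y = R" for y
      using z(2)[of y] that k(3) by simp
  qed (use R1 k R in auto)
  then show ?thesis
    unfolding decays_at_most_def eventually_at_infinity using k(1) by blast
qed

section \<open>Lowering the decay exponent\<close>

text \<open>For \<open>\<gamma>\<close> above the exponent \<open>(N - q)/(q - 1)\<close> of the fundamental solution, \<open>k |x|\<^sup>-\<^sup>\<gamma>\<close> is a strict
  subsolution for both operators (for \<open>\<Delta>\<^sub>p\<close> because \<open>q < p\<close>), so the right-hand side can be
  estimated by zero.\<close>

lemma decays_at_most_above_fundamental:
  fixes u :: "real ^ 'n \<Rightarrow> real"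
  assumes exps: "1 < q" "q < p" "0 \<le> s" "0 \<le> m"
    and sol: "pq_solution p q s m \<Omega> u" and ext: "exterior_domain \<Omega>"
    and upos: "\<And>x. x \<in> \<Omega> \<Longrightarrow> 0 < u x"
    and \<gamma>: "0 < \<gamma>" "real CARD('n) - q < \<gamma> * (q - 1)"
  shows "decays_at_most \<gamma> u"
proof (rule decays_at_most_barrier[OF _ exps(1,3,4) sol ext upos, of 1])
  have neg: "neg_laplace_power (real CARD('n)) t k \<gamma> r < 0" if "q \<le> t" "0 < k" "0 < r" for t k r
  proof -
    have "(\<gamma> + 1) * (t - 1) + 1 = \<gamma> * (t - 1) + t" by (simp add: algebra_simps)
    have "\<gamma> * (q - 1) \<le> \<gamma> * (t - 1)" using that \<gamma> by (intro mult_left_mono) auto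
    with \<gamma>(2) have "real CARD('n) - q < \<gamma> * (t - 1)" by (rule order.strict_trans2)
    then have "real CARD('n) - ((\<gamma> + 1) * (t - 1) + 1) < 0"
      using that(1) \<open>(\<gamma> + 1) * (t - 1) + 1 = \<gamma> * (t - 1) + t\<close> by linarith
    then show ?thesis
      unfolding neg_laplace_power_def using that \<gamma> by (intro mult_neg_pos mult_pos_neg) auto
  qed
  have "neg_laplace_power (real CARD('n)) p k \<gamma> (norm x) + neg_laplace_power (real CARD('n)) q k \<gamma> (norm x)
        < npow (u x) s * npow (norm (grad u x)) m" if "1 \<le> norm x" "0 < k" for x k
  proof -
    have "0 < norm x" using that by linarith
    then show ?thesis
      using neg[of p k "norm x"] neg[of q k "norm x"] that exps
        mult_nonneg_nonneg[OF npow_nonneg[of "u x" s] npow_nonneg[of "norm (grad u x)" m]]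
      by linarith
  qed
  then show "\<forall>\<^sub>F x in at_infinity. \<forall>k. 0 < k \<and> k \<le> 1 \<and>
        grad u x = - (k * \<gamma> * norm x powr (-\<gamma>-2)) *\<^sub>R x \<longrightarrow>
      neg_laplace_power (real CARD('n)) p k \<gamma> (norm x) + neg_laplace_power (real CARD('n)) q k \<gamma> (norm x)
        < npow (u x) s * npow (norm (grad u x)) m"
    unfolding eventually_at_infinity by blast
qed (use exps \<gamma> in auto)

text \<open>The restriction \<open>m \<le> q - 1\<close> enters here: for \<open>k \<gamma> \<le> 1\<close> it allows the factor \<open>(k \<gamma>)\<^sup>m\<close> to be split
  off. The gradient term of the barrier contains the same factor, so it cancels and the amplitude
  disappears from the comparison. For \<open>r \<ge> 1\<close> the weakest decay, that of \<open>t = q\<close>, dominates.\<close>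

lemma neg_laplace_power_le:
  assumes "1 < q" "q \<le> t" "0 \<le> m" "m \<le> q - 1" "0 < k" "0 < \<gamma>" "k * \<gamma> \<le> 1" "1 \<le> r" "0 \<le> N"
  shows "neg_laplace_power N t k \<gamma> r \<le> (k * \<gamma>) powr m * N * r powr (- ((\<gamma> + 1) * (q - 1) + 1))"
proof -
  have "(\<gamma> + 1) * (q - 1) \<le> (\<gamma> + 1) * (t - 1)" using assms by (intro mult_left_mono) auto
  moreover have "0 \<le> (\<gamma> + 1) * (q - 1)" using assms by simp
  ultimately have b: "N - ((\<gamma> + 1) * (t - 1) + 1) \<le> N"
    "- ((\<gamma> + 1) * (t - 1) + 1) \<le> - ((\<gamma> + 1) * (q - 1) + 1)" by linarith+
  have "(k * \<gamma>) powr (t - 1) \<le> (k * \<gamma>) powr m"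
    using assms by (intro powr_mono') auto
  moreover have "r powr (- ((\<gamma> + 1) * (t - 1) + 1)) \<le> r powr (- ((\<gamma> + 1) * (q - 1) + 1))"
    using assms b by (intro powr_mono) auto
  moreover have "(k * \<gamma>) powr (t - 1) * (N - ((\<gamma> + 1) * (t - 1) + 1)) \<le> (k * \<gamma>) powr (t - 1) * N"
    using b by (intro mult_left_mono) auto
  ultimately have "(k * \<gamma>) powr (t - 1) * (N - ((\<gamma> + 1) * (t - 1) + 1)) \<le> (k * \<gamma>) powr m * N"
    using assms by (meson mult_right_mono order.trans)
  then have "neg_laplace_power N t k \<gamma> r \<le> (k * \<gamma>) powr m * N * r powr (- ((\<gamma> + 1) * (t - 1) + 1))"
    unfolding neg_laplace_power_def by (intro mult_right_mono) auto
  also have "\<dots> \<le> (k * \<gamma>) powr m * N * r powr (- ((\<gamma> + 1) * (q - 1) + 1))"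
    using \<open>r powr _ \<le> r powr _\<close> assms by (intro mult_left_mono) auto
  finally show ?thesis .
qed

text \<open>The known bound turns the right-hand side into at least \<open>(c |x|\<^sup>-\<^sup>\<gamma>)\<^sup>s |grad u|\<^sup>m\<close>. Evaluated on the
  gradient of \<open>k |x| powr (-\<gamma>')\<close>, this decays more slowly than the two Laplacians of that power when
  the second condition on \<open>\<gamma>'\<close> holds, so the slower power is a barrier for all large \<open>|x|\<close>.\<close>

lemma decays_at_most_improve:
  fixes u :: "real ^ 'n \<Rightarrow> real"
  assumes exps: "1 < q" "q < p" "0 \<le> s" "0 \<le> m" "m \<le> q - 1"
    and sol: "pq_solution p q s m \<Omega> u" and ext: "exterior_domain \<Omega>"
    and upos: "\<And>x. x \<in> \<Omega> \<Longrightarrow> 0 < u x"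
    and old: "decays_at_most \<gamma> u"
    and \<gamma>': "0 < \<gamma>'" "0 < (\<gamma>' + 1) * (q - 1 - m) + 1 - \<gamma> * s"
  shows "decays_at_most \<gamma>' u"
proof (rule decays_at_most_barrier[OF _ exps(1,3,4) sol ext upos, of "1 / \<gamma>'"])
  let ?N = "real CARD('n)"
  let ?e = "(\<gamma>' + 1) * (q - 1 - m) + 1 - \<gamma> * s"
  obtain c where c: "0 < c" and low: "\<forall>\<^sub>F x in at_infinity. c * norm x powr (-\<gamma>) \<le> u x"
    using old by (auto simp: decays_at_most_def)
  have "filterlim (\<lambda>r::real. c powr s * r powr ?e) at_top at_top"
    using c \<gamma>' by (intro filterlim_tendsto_pos_mult_at_top[OF tendsto_const] real_powr_at_top) auto
  then have "\<forall>\<^sub>F r in at_top. 2 * ?N < c powr s * r powr ?e"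
    by (simp add: filterlim_at_top_dense)
  then have "\<forall>\<^sub>F x::real^'n in at_infinity. 2 * ?N < c powr s * norm x powr ?e"
    using filterlim_norm_at_top by (rule eventually_compose_filterlim)
  moreover have "\<forall>\<^sub>F x::real^'n in at_infinity. 1 \<le> norm x"
    unfolding eventually_at_infinity by blast
  ultimately show "\<forall>\<^sub>F x in at_infinity. \<forall>k. 0 < k \<and> k \<le> 1 / \<gamma>' \<and>
        grad u x = - (k * \<gamma>' * norm x powr (-\<gamma>'-2)) *\<^sub>R x \<longrightarrow>
      neg_laplace_power ?N p k \<gamma>' (norm x) + neg_laplace_power ?N q k \<gamma>' (norm x)
        < npow (u x) s * npow (norm (grad u x)) m"
    using low
  proof (eventually_elim, intro allI impI, elim conjE)
    fix x :: "real^'n" and k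
    assume big: "2 * ?N < c powr s * norm x powr ?e" and x: "1 \<le> norm x"
      and ux: "c * norm x powr (-\<gamma>) \<le> u x"
      and k: "0 < k" "k \<le> 1 / \<gamma>'"
      and touch: "grad u x = - (k * \<gamma>' * norm x powr (-\<gamma>'-2)) *\<^sub>R x"
    let ?b = "(\<gamma>' + 1) * (q - 1) + 1"
    have nz: "x \<noteq> 0" and r: "0 < norm x" using x by auto
    have k1: "k * \<gamma>' \<le> 1" using k(2) \<gamma>'(1) by (simp add: field_simps)
    note le = neg_laplace_power_le[OF exps(1) _ exps(4,5) k(1) \<gamma>'(1) k1 x, of _ ?N]
    have "0 < c * norm x powr (-\<gamma>)" using c r by simp
    then have "npow (u x) s = u x powr s" "(c * norm x powr (-\<gamma>)) powr s \<le> u x powr s"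
      using ux exps by (auto intro!: npow_eq_powr powr_mono2)
    then have us: "c powr s * norm x powr (-\<gamma> * s) \<le> npow (u x) s"
      using c r by (simp add: powr_mult powr_powr)
    have "0 < k * \<gamma>' * norm x powr (- (\<gamma>' + 1))" using k \<gamma>' r by simp
    then have gm: "npow (norm (grad u x)) m = (k * \<gamma>') powr m * norm x powr (- (\<gamma>' + 1) * m)"
      unfolding touch norm_grad_power_barrier[OF nz k(1) \<gamma>'(1)]
      using k \<gamma>' r by (simp add: npow_eq_powr powr_mult powr_powr)
    have "neg_laplace_power ?N p k \<gamma>' (norm x) + neg_laplace_power ?N q k \<gamma>' (norm x)
        \<le> (k * \<gamma>') powr m * norm x powr (- ?b) * (2 * ?N)"
      using le[of p] le[of q] exps by (simp add: algebra_simps)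
    also have "\<dots> < (k * \<gamma>') powr m * norm x powr (- ?b) * (c powr s * norm x powr ?e)"
      using big k \<gamma>' r by (intro mult_strict_left_mono) auto
    also have "\<dots> = (k * \<gamma>') powr m * c powr s * (norm x powr (- ?b) * norm x powr ?e)"
      by (simp only: mult_ac)
    also have "norm x powr (- ?b) * norm x powr ?e = norm x powr (-\<gamma> * s) * norm x powr (- (\<gamma>' + 1) * m)"
      unfolding powr_add[symmetric] by (rule arg_cong[where f="(powr) (norm x)"]) (simp add: algebra_simps)
    also have "(k * \<gamma>') powr m * c powr s * \<dots> = c powr s * norm x powr (-\<gamma> * s) * npow (norm (grad u x)) m"
      unfolding gm by (simp only: mult_ac)
    also have "\<dots> \<le> npow (u x) s * npow (norm (grad u x)) m"
      by (intro mult_right_mono us npow_nonneg)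
    finally show "neg_laplace_power ?N p k \<gamma>' (norm x) + neg_laplace_power ?N q k \<gamma>' (norm x)
        < npow (u x) s * npow (norm (grad u x)) m" .
  qed
qed (use exps \<gamma>' in auto)

text \<open>Let \<open>H(\<gamma>)\<close> be the margin in the previous lemma when \<open>\<gamma>' = \<gamma>\<close>. It is affine in \<open>\<gamma>\<close>, equals
  \<open>q - m > 0\<close> at \<open>\<gamma> = 0\<close>, and at the fundamental exponent \<open>\<gamma>0\<close> its positivity is the
  hypothesis on \<open>s\<close> and \<open>m\<close>, up to the factor \<open>q - 1\<close>. Hence it is bounded below on an interval \<open>[0, \<gamma>1]\<close> with
  \<open>\<gamma>1 > \<gamma>0\<close>, the exponent can be lowered by a fixed amount in each step, and finitely many steps lead
  from \<open>\<gamma>1\<close> down to \<open>\<theta>\<close>.\<close>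

lemma decays_at_most_every_power:
  fixes u :: "real ^ 'n \<Rightarrow> real"
  assumes exps: "1 < q" "q < p" "q < real CARD('n)" "0 \<le> s" "0 \<le> m" "m \<le> q - 1"
    and sub: "s * (real CARD('n) - q) + m * (real CARD('n) - 1) < real CARD('n) * (q - 1)"
    and sol: "pq_solution p q s m \<Omega> u" and ext: "exterior_domain \<Omega>"
    and upos: "\<And>x. x \<in> \<Omega> \<Longrightarrow> 0 < u x"
    and \<theta>: "0 < \<theta>"
  shows "decays_at_most \<theta> u"
proof -
  let ?N = "real CARD('n)"
  define a where "a = q - 1 - m - s"
  define H where "H \<gamma> = (\<gamma> + 1) * (q - 1 - m) + 1 - \<gamma> * s" for \<gamma>
  have H: "H \<gamma> = q - m + \<gamma> * a" for \<gamma> by (simp add: H_def a_def algebra_simps)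
  define \<gamma>0 where "\<gamma>0 = (?N - q) / (q - 1)"
  have \<gamma>s: "0 < \<gamma>0" "\<gamma>0 * (q - 1) = ?N - q" using exps by (auto simp: \<gamma>0_def)
  have "H \<gamma>0 * (q - 1) = ?N * (q - 1) - (s * (?N - q) + m * (?N - 1))"
  proof -
    have "H \<gamma>0 * (q - 1) = (q - m) * (q - 1) + (\<gamma>0 * (q - 1)) * a"
      by (simp add: H algebra_simps)
    then show ?thesis unfolding \<gamma>s(2) a_def by (simp add: algebra_simps)
  qed
  then have "0 < H \<gamma>0 * (q - 1)" using sub by simp
  then have Hs: "0 < H \<gamma>0" using exps by (simp add: zero_less_mult_iff)
  \<comment> \<open>The shift is small enough for \<open>H\<close> to keep at least half of its value at \<open>\<gamma>0\<close>, whatever the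
    sign of the slope \<open>a\<close>.\<close>
  define \<gamma>1 where "\<gamma>1 = \<gamma>0 + H \<gamma>0 / (2 * (\<bar>a\<bar> + 1))"
  have \<gamma>1: "\<gamma>0 < \<gamma>1" using Hs by (simp add: \<gamma>1_def add_pos_nonneg)
  have H1: "0 < H \<gamma>1"
  proof -
    have "H \<gamma>1 = H \<gamma>0 * (1 + a / (2 * (\<bar>a\<bar> + 1)))"
      unfolding H \<gamma>1_def by (simp add: algebra_simps)
    moreover have "0 < 1 + a / (2 * (\<bar>a\<bar> + 1))"
      by (simp add: field_simps add_pos_nonneg)
    ultimately show ?thesis using Hs by simp
  qed
  define h where "h = min (q - m) (H \<gamma>1)"
  have h: "0 < h" using H1 exps by (simp add: h_def)
  have H_ge: "h \<le> H \<gamma>" if "0 \<le> \<gamma>" "\<gamma> \<le> \<gamma>1" for \<gamma>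
  proof (cases "0 \<le> a")
    case True
    then show ?thesis using that by (simp add: H h_def min_le_iff_disj)
  next
    case False
    then have "\<gamma>1 * a \<le> \<gamma> * a" using that by (intro mult_right_mono_neg) auto
    then show ?thesis by (simp add: H h_def min_le_iff_disj)
  qed
  have above: "decays_at_most \<gamma> u" if "\<gamma>0 < \<gamma>" for \<gamma>
  proof (rule decays_at_most_above_fundamental[OF exps(1,2,4,5) sol ext upos])
    show "?N - q < \<gamma> * (q - 1)" using that exps \<gamma>s(2) by (metis diff_gt_0_iff_gt mult_strict_right_mono)
  qed (use that \<gamma>s in auto)
  \<comment> \<open>Lowering \<open>\<gamma>\<close> by \<open>\<delta>\<close> costs at most \<open>\<delta> (q - 1 - m) < \<delta> q = h\<close> of the margin.\<close>
  define \<delta> where "\<delta> = h / q"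
  have \<delta>: "0 < \<delta>" using h exps by (simp add: \<delta>_def)
  have iter: "decays_at_most (max \<theta> (\<gamma>1 - real n * \<delta>)) u" if "\<theta> < \<gamma>1" for n
  proof (induction n)
    case 0
    then show ?case using above[OF \<gamma>1] that by simp
  next
    case (Suc n)
    let ?\<gamma> = "max \<theta> (\<gamma>1 - real n * \<delta>)" and ?\<gamma>' = "max \<theta> (\<gamma>1 - real (Suc n) * \<delta>)"
    show ?case
    proof (rule decays_at_most_improve[OF exps(1,2,4,5,6) sol ext upos Suc])
      have "real n * \<delta> \<ge> 0" using \<delta> by simp
      then have "h \<le> H ?\<gamma>" using that \<theta> by (intro H_ge) auto
      moreover have "(?\<gamma> - ?\<gamma>') * (q - 1 - m) \<le> \<delta> * (q - 1 - m)"
        using exps \<delta> by (intro mult_right_mono) (auto simp: max_def algebra_simps)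
      moreover have "\<delta> * (q - 1 - m) < \<delta> * q" using \<delta> exps by (intro mult_strict_left_mono) auto
      moreover have "\<delta> * q = h" using exps by (simp add: \<delta>_def)
      ultimately have "0 < H ?\<gamma> - (?\<gamma> - ?\<gamma>') * (q - 1 - m)" by linarith
      then show "0 < (?\<gamma>' + 1) * (q - 1 - m) + 1 - ?\<gamma> * s"
        unfolding H_def by (simp only: algebra_simps)
    qed (use \<theta> in auto)
  qed
  show ?thesis
  proof (cases "\<theta> < \<gamma>1")
    case True
    obtain n where "\<gamma>1 < real n * \<delta>" using reals_Archimedean3[OF \<delta>] by blast
    then have "max \<theta> (\<gamma>1 - real n * \<delta>) = \<theta>" using \<theta> by simp
    then show ?thesis using iter[OF True, of n] by simp
  next
    case False
    then show ?thesis using \<gamma>1 by (intro above) simp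
  qed
qed

theorem lemma1p3:
  fixes p q s m :: real
    and \<Omega> :: "(real ^ 'n) set"
    and u :: "real ^ 'n \<Rightarrow> real"
  assumes "1 < q" and "q < p" and "q < real CARD('n)"
    and "0 \<le> s" and "0 \<le> m" and "m \<le> q - 1"
    and "s * (real CARD('n) - q) + m * (real CARD('n) - 1) < real CARD('n) * (q - 1)"
    and "exterior_domain \<Omega>"
    and "continuous_on (closure \<Omega>) u"
    and "\<forall>x\<in>closure \<Omega>. 0 < u x"
    and "pq_solution p q s m \<Omega> u"
  shows "\<forall>\<theta>>0. \<exists>C>0. \<forall>x\<in>closure \<Omega> \<inter> {x. norm x \<ge> 1}. u x \<ge> C * norm x powr (-\<theta>)"
proof (intro allI impI)
  fix \<theta> :: real
  assume \<theta>: "0 < \<theta>"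
  have "decays_at_most \<theta> u"
  proof (rule decays_at_most_every_power[OF assms(1-7) assms(11) assms(8) _ \<theta>])
    show "0 < u x" if "x \<in> \<Omega>" for x using assms(10) that closure_subset by blast
  qed
  then obtain c R where c: "0 < c" "\<And>x. R \<le> norm x \<Longrightarrow> c * norm x powr (-\<theta>) \<le> u x"
    unfolding decays_at_most_def eventually_at_infinity by blast
  \<comment> \<open>On the remaining compact part, \<open>u\<close> has a positive lower bound and \<open>|x| powr (-\<theta>) \<le> 1\<close>.\<close>
  define A where "A = closure \<Omega> \<inter> cball 0 R"
  have "compact A" unfolding A_def by (intro closed_Int_compact) auto
  moreover have "continuous_on A u" using assms(9) by (rule continuous_on_subset) (simp add: A_def)
  ultimately obtain c' where c': "0 < c'" "\<And>x. x \<in> A \<Longrightarrow> c' \<le> u x"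
  proof (cases "A = {}")
    case False
    then obtain z where "z \<in> A" "\<And>y. y \<in> A \<Longrightarrow> u z \<le> u y"
      using continuous_attains_inf[OF \<open>compact A\<close> False \<open>continuous_on A u\<close>] by blast
    then show thesis using assms(10) by (intro that[of "u z"]) (auto simp: A_def)
  qed (use zero_less_one in blast)
  show "\<exists>C>0. \<forall>x\<in>closure \<Omega> \<inter> {x. norm x \<ge> 1}. u x \<ge> C * norm x powr (-\<theta>)"
  proof (intro exI[of _ "min c c'"] conjI ballI)
    fix x assume x: "x \<in> closure \<Omega> \<inter> {x. norm x \<ge> 1}"
    show "min c c' * norm x powr (-\<theta>) \<le> u x"
    proof (cases "R \<le> norm x")
      case True
      have "min c c' * norm x powr (-\<theta>) \<le> c * norm x powr (-\<theta>)"
        by (intro mult_right_mono) auto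
      then show ?thesis using c(2)[OF True] by linarith
    next
      case False
      have "norm x powr (-\<theta>) \<le> norm x powr 0"
        using x \<theta> by (intro powr_mono) auto
      then have "norm x powr (-\<theta>) \<le> 1" by (simp split: if_splits)
      then have "min c c' * norm x powr (-\<theta>) \<le> c' * 1"
        using c(1) c'(1) by (intro mult_mono) auto
      moreover have "c' \<le> u x" using False x by (intro c'(2)) (simp add: A_def)
      ultimately show ?thesis by linarith
    qed
  qed (use c c' in auto)
qed

end
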